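(* Let $\tau_1=(12)(34)$, $\tau_2=(14)(23)$, $\tau_3=(13)(24)\in\text{Sym}_4$, and let $L_1=L(\tau_1,\tau_2,\tau_1)$, $L_2=L(\tau_2,\tau_3,\tau_2)$, $L_3=L(\tau_3,\tau_1,\tau_3)$. Then: (1) $L_1,L_2,L_3$ are mutually orthogonal; (2) all pairs $(L_i,L_j)$ with $i\neq j$ are $\sim'$-equivalent to one another; (3) every element of $OLS_4$ is $\sim'$-equivalent to $(L_1,L_2)$, i.e. $OLS_4/\sim'=\{[(L_1,L_2)]\}$ has exactly one element.
   Context: A Latin square of size $k$ is a $k\times k$ array with entries in $\{1,\dots,k\}$ with no repetition in any row or column. For fixed-point-free permutations $\sigma_{12},\sigma_{23},\sigma_{34}\in\text{Sym}_4$, $L(\sigma_{12},\sigma_{23},\sigma_{34})$ denotes the $4\times4$ array whose first row is $(1,2,3,4)$ and whose row $i+1$ is obtained by applying $\sigma_{i,i+1}$ entrywise to row $i$. Two Latin squares $L,L'$ are orthogonal if $(i,j)\mapsto(L_{ij},L'_{ij})$ is a bijection of $\{1,\dots,k\}^2$; $OLS_k$ is the set of ordered orthogonal pairs of size $k$. $(L_1,L_2)\sim'(L_1',L_2')$ means one can pass from one pair to the other by a finite sequence of: (R1) exchange rows $i$ and $j$ in both squares; (R2) exchange columns $i$ and $j$ in both squares; (R3) exchange two symbols in the first square; (R4) exchange two symbols in the second square; (R5) transpose one of the squares; (R6) swap the two squares. *)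

theory Defs
  imports Main "HOL-Library.FuncSet" "HOL-Combinatorics.Transposition"
begin

type_synonym square = "nat \<times> nat \<Rightarrow> nat"

definition cells :: "nat \<Rightarrow> (nat \<times> nat) set" where
  "cells k = {1..k} \<times> {1..k}"

text \<open>Arrays are extensional functions on the cells \<open>(row, column)\<close>, so that equality of
  functions is equality of arrays.\<close>

definition latin_square :: "nat \<Rightarrow> square \<Rightarrow> bool" where
  "latin_square k L \<longleftrightarrow>
     L \<in> cells k \<rightarrow>\<^sub>E {1..k} \<and>
     (\<forall>i\<in>{1..k}. inj_on (\<lambda>j. L (i, j)) {1..k}) \<and>
     (\<forall>j\<in>{1..k}. inj_on (\<lambda>i. L (i, j)) {1..k})"

definition orthogonal :: "nat \<Rightarrow> square \<Rightarrow> square \<Rightarrow> bool" where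
  "orthogonal k L L' \<longleftrightarrow> bij_betw (\<lambda>p. (L p, L' p)) (cells k) (cells k)"

definition OLS :: "nat \<Rightarrow> (square \<times> square) set" where
  "OLS k = {(L, L'). latin_square k L \<and> latin_square k L' \<and> orthogonal k L L'}"

definition square_of_perms ::
  "(nat \<Rightarrow> nat) \<Rightarrow> (nat \<Rightarrow> nat) \<Rightarrow> (nat \<Rightarrow> nat) \<Rightarrow> square" where
  "square_of_perms \<sigma>12 \<sigma>23 \<sigma>34 =
     (\<lambda>(i, j)\<in>cells 4.
        if i = 1 then j
        else if i = 2 then \<sigma>12 j
        else if i = 3 then \<sigma>23 (\<sigma>12 j)
        else \<sigma>34 (\<sigma>23 (\<sigma>12 j)))"

definition swap_rows :: "nat \<Rightarrow> nat \<Rightarrow> square \<Rightarrow> square" where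
  "swap_rows a b L = (\<lambda>(i, j). L (transpose a b i, j))"

definition swap_cols :: "nat \<Rightarrow> nat \<Rightarrow> square \<Rightarrow> square" where
  "swap_cols a b L = (\<lambda>(i, j). L (i, transpose a b j))"

definition swap_symbols :: "nat \<Rightarrow> nat \<Rightarrow> nat \<Rightarrow> square \<Rightarrow> square" where
  "swap_symbols k a b L = (\<lambda>p\<in>cells k. transpose a b (L p))"

definition transpose_square :: "square \<Rightarrow> square" where
  "transpose_square L = (\<lambda>(i, j). L (j, i))"

inductive_set ols_move :: "nat \<Rightarrow> ((square \<times> square) \<times> (square \<times> square)) set"
  for k :: nat where
  R1: "a \<in> {1..k} \<Longrightarrow> b \<in> {1..k} \<Longrightarrow>
         ((L, L'), (swap_rows a b L, swap_rows a b L')) \<in> ols_move k"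
| R2: "a \<in> {1..k} \<Longrightarrow> b \<in> {1..k} \<Longrightarrow>
         ((L, L'), (swap_cols a b L, swap_cols a b L')) \<in> ols_move k"
| R3: "a \<in> {1..k} \<Longrightarrow> b \<in> {1..k} \<Longrightarrow>
         ((L, L'), (swap_symbols k a b L, L')) \<in> ols_move k"
| R4: "a \<in> {1..k} \<Longrightarrow> b \<in> {1..k} \<Longrightarrow>
         ((L, L'), (L, swap_symbols k a b L')) \<in> ols_move k"
| R5_fst: "((L, L'), (transpose_square L, L')) \<in> ols_move k"
| R5_snd: "((L, L'), (L, transpose_square L')) \<in> ols_move k"
| R6: "((L, L'), (L', L)) \<in> ols_move k"

text \<open>Transposing only one square can destroy orthogonality. The equivalence on \<open>OLS k\<close> is
  generated by those moves that lead from an orthogonal pair to an orthogonal pair, so every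
  pair occurring in a sequence of moves lies in \<open>OLS k\<close>. This is at least as fine as the relation
  that lets sequences leave \<open>OLS k\<close>; see \<open>ols_equiv_subset\<close>.\<close>

definition ols_equiv :: "nat \<Rightarrow> ((square \<times> square) \<times> (square \<times> square)) set" where
  "ols_equiv k = Restr ((Restr (ols_move k) (OLS k))\<^sup>*) (OLS k)"

lemma ols_equiv_subset: "ols_equiv k \<subseteq> Restr ((ols_move k)\<^sup>*) (OLS k)"
  unfolding ols_equiv_def using rtrancl_mono[of "Restr (ols_move k) (OLS k)" "ols_move k"] by blast

lemma swap_symbols_involutory:
  assumes "latin_square k L"
  shows "swap_symbols k a b (swap_symbols k a b L) = L"
proof
  fix p show "swap_symbols k a b (swap_symbols k a b L) p = L p"
    using assms PiE_arb[of L "cells k" "\<lambda>_. {1..k}" p]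
    by (cases "p \<in> cells k") (auto simp: swap_symbols_def latin_square_def)
qed

lemma sym_ols_move: "sym (Restr (ols_move k) (OLS k))"
proof (rule symI)
  fix P Q assume PQ: "(P, Q) \<in> Restr (ols_move k) (OLS k)"
  then have P: "P \<in> OLS k" and "(P, Q) \<in> ols_move k" by auto
  obtain A B C D where [simp]: "P = (A, B)" "Q = (C, D)" by (cases P, cases Q)
  from \<open>(P, Q) \<in> ols_move k\<close> have "((A, B), (C, D)) \<in> ols_move k" by simp
  then have "(Q, P) \<in> ols_move k"
  proof cases
    case (R1 a b)
    have "swap_rows a b (swap_rows a b M) = M" for M by (auto simp: swap_rows_def)
    with R1 show ?thesis using ols_move.R1[of a k b "swap_rows a b A" "swap_rows a b B"] by simp
  next
    case (R2 a b)
    have "swap_cols a b (swap_cols a b M) = M" for M by (auto simp: swap_cols_def)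
    with R2 show ?thesis using ols_move.R2[of a k b "swap_cols a b A" "swap_cols a b B"] by simp
  next
    case (R3 a b)
    with P have "swap_symbols k a b (swap_symbols k a b A) = A"
      by (intro swap_symbols_involutory) (auto simp: OLS_def)
    with R3 show ?thesis using ols_move.R3[of a k b "swap_symbols k a b A" B] by simp
  next
    case (R4 a b)
    with P have "swap_symbols k a b (swap_symbols k a b B) = B"
      by (intro swap_symbols_involutory) (auto simp: OLS_def)
    with R4 show ?thesis using ols_move.R4[of a k b A "swap_symbols k a b B"] by simp
  next
    case R5_fst
    have "transpose_square (transpose_square A) = A" by (auto simp: transpose_square_def)
    with R5_fst show ?thesis using ols_move.R5_fst[of "transpose_square A" B k] by simp
  next
    case R5_snd
    have "transpose_square (transpose_square B) = B" by (auto simp: transpose_square_def)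
    with R5_snd show ?thesis using ols_move.R5_snd[of A "transpose_square B" k] by simp
  next
    case R6
    then show ?thesis using ols_move.R6[of B A k] by simp
  qed
  with PQ show "(Q, P) \<in> Restr (ols_move k) (OLS k)" by auto
qed

lemma equiv_ols_equiv: "equiv (OLS k) (ols_equiv k)"
proof (rule equivI)
  show "ols_equiv k \<subseteq> OLS k \<times> OLS k" by (auto simp: ols_equiv_def)
  show "refl_on (OLS k) (ols_equiv k)" by (auto simp: ols_equiv_def refl_on_def)
  show "sym (ols_equiv k)"
    using sym_rtrancl[OF sym_ols_move] unfolding ols_equiv_def sym_def by blast
  show "trans (ols_equiv k)"
    unfolding ols_equiv_def using trans_rtrancl by (rule trans_Restr)
qed

end

theory Submission
  imports Defs
begin

text \<open>Relabelling symbols and permuting rows turns every orthogonal pair into one whose two first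
  rows and whose first column in the first square are increasing. For size 4 there are four such
  first squares; the three cyclic ones have no orthogonal mate, and the table \<open>L\<^sub>1\<close> of the Klein
  group has exactly the mates \<open>L\<^sub>2\<close> and \<open>L\<^sub>3\<close>. Exchanging 3 and 4 among rows, columns and symbols
  fixes \<open>L\<^sub>1\<close>, being an automorphism of the Klein group, and exchanges \<open>L\<^sub>2\<close> and \<open>L\<^sub>3\<close>.\<close>

section \<open>Moves that preserve orthogonal pairs\<close>

lemma swap_rows_in_OLS:
  assumes "a \<in> {1..k}" "b \<in> {1..k}" "(A, B) \<in> OLS k"
  shows "(swap_rows a b A, swap_rows a b B) \<in> OLS k"
proof -
  let ?t = "transpose a b"
  have t: "?t i \<in> {1..k} \<longleftrightarrow> i \<in> {1..k}" for i
    using assms(1,2) by (auto simp: transpose_def)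
  have lat: "latin_square k (swap_rows a b M)" if "latin_square k M" for M
    unfolding latin_square_def
  proof (intro conjI ballI)
    show "swap_rows a b M \<in> cells k \<rightarrow>\<^sub>E {1..k}"
    proof (rule PiE_I)
      fix p assume "p \<in> cells k"
      then show "swap_rows a b M p \<in> {1..k}"
        using that t by (cases p) (auto simp: swap_rows_def latin_square_def cells_def)
    next
      \<comment> \<open>Outside the cells the value must stay \<open>undefined\<close>. This uses
        the converse half of \<open>t\<close>: an index outside the range is not moved into
        it.\<close>
      fix p assume "p \<notin> cells k"
      then have "(?t (fst p), snd p) \<notin> cells k" using t by (cases p) (auto simp: cells_def)
      then show "swap_rows a b M p = undefined"
        using that by (cases p) (auto simp: swap_rows_def latin_square_def dest: PiE_arb)
    qed
  next
    fix i assume "i \<in> {1..k}"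
    then show "inj_on (\<lambda>j. swap_rows a b M (i, j)) {1..k}"
      using that t[of i] by (auto simp: swap_rows_def latin_square_def)
  next
    fix j assume "j \<in> {1..k}"
    then have inj: "inj_on (\<lambda>i. M (i, j)) {1..k}"
      using that by (auto simp: latin_square_def)
    show "inj_on (\<lambda>i. swap_rows a b M (i, j)) {1..k}"
    proof (rule inj_onI)
      fix x y
      assume "x \<in> {1..k}" "y \<in> {1..k}" "swap_rows a b M (x, j) = swap_rows a b M (y, j)"
      then have "?t x = ?t y" using inj t by (auto simp: swap_rows_def dest: inj_onD)
      then show "x = y" by (metis transpose_involutory)
    qed
  qed
  \<comment> \<open>The cell map of the new pair is that of the old pair precomposed with the
    involution \<open>?f\<close> of the cells, hence again bijective.\<close>
  let ?f = "\<lambda>(i, j). (?t i, j)"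
  have "bij_betw ?f (cells k) (cells k)"
    by (rule bij_betw_byWitness[where f' = ?f]) (auto simp: cells_def t simp del: atLeastAtMost_iff One_nat_def)
  then have "bij_betw ((\<lambda>p. (A p, B p)) \<circ> ?f) (cells k) (cells k)"
    using assms(3) by (auto simp: OLS_def orthogonal_def intro: bij_betw_trans)
  moreover have "(\<lambda>p. (A p, B p)) \<circ> ?f = (\<lambda>p. (swap_rows a b A p, swap_rows a b B p))"
    by (auto simp: swap_rows_def)
  ultimately show ?thesis using assms(3) lat by (auto simp: OLS_def orthogonal_def)
qed

text \<open>Transposing both squares at once only reflects the cells, so unlike a single
  transposition it always keeps orthogonality. It serves to carry facts about rows over to
  columns.\<close>

lemma transpose_both_in_OLS:
  assumes "(A, B) \<in> OLS k"
  shows "(transpose_square A, transpose_square B) \<in> OLS k"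
proof -
  have lat: "latin_square k (transpose_square M)" if "latin_square k M" for M
  proof -
    have "transpose_square M \<in> cells k \<rightarrow>\<^sub>E {1..k}"
    proof (rule PiE_I)
      fix p assume "p \<in> cells k"
      then show "transpose_square M p \<in> {1..k}"
        using that by (cases p) (auto simp: transpose_square_def latin_square_def cells_def)
    next
      fix p assume "p \<notin> cells k"
      then have "(snd p, fst p) \<notin> cells k" by (cases p) (auto simp: cells_def)
      then show "transpose_square M p = undefined"
        using that by (cases p) (auto simp: transpose_square_def latin_square_def dest: PiE_arb)
    qed
    then show ?thesis using that by (auto simp: transpose_square_def latin_square_def)
  qed
  let ?f = "\<lambda>(i, j). (j, i)"
  have "bij_betw ?f (cells k) (cells k)"
    by (rule bij_betw_byWitness[where f' = ?f]) (auto simp: cells_def)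
  then have "bij_betw ((\<lambda>p. (A p, B p)) \<circ> ?f) (cells k) (cells k)"
    using assms by (auto simp: OLS_def orthogonal_def intro: bij_betw_trans)
  moreover have "(\<lambda>p. (A p, B p)) \<circ> ?f = (\<lambda>p. (transpose_square A p, transpose_square B p))"
    by (auto simp: transpose_square_def)
  ultimately show ?thesis using assms lat by (auto simp: OLS_def orthogonal_def)
qed

text \<open>A column exchange is a row exchange conjugated by the simultaneous
  transposition.\<close>

lemma swap_cols_in_OLS:
  assumes "a \<in> {1..k}" "b \<in> {1..k}" "(A, B) \<in> OLS k"
  shows "(swap_cols a b A, swap_cols a b B) \<in> OLS k"
proof -
  have "swap_cols a b M = transpose_square (swap_rows a b (transpose_square M))" for M
    by (auto simp: swap_cols_def swap_rows_def transpose_square_def)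
  then show ?thesis
    using assms by (simp add: swap_rows_in_OLS transpose_both_in_OLS)
qed

lemma swap_squares_in_OLS:
  assumes "(A, B) \<in> OLS k"
  shows "(B, A) \<in> OLS k"
proof -
  let ?f = "\<lambda>(i, j). (j, i)"
  have "bij_betw ?f (cells k) (cells k)"
    by (rule bij_betw_byWitness[where f' = ?f]) (auto simp: cells_def)
  then have "bij_betw (?f \<circ> (\<lambda>p. (A p, B p))) (cells k) (cells k)"
    using assms by (auto simp: OLS_def orthogonal_def intro: bij_betw_trans)
  then show ?thesis using assms by (simp add: OLS_def orthogonal_def comp_def)
qed

lemma swap_symbols_fst_in_OLS:
  assumes "a \<in> {1..k}" "b \<in> {1..k}" "(A, B) \<in> OLS k"
  shows "(swap_symbols k a b A, B) \<in> OLS k"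
proof -
  let ?t = "transpose a b"
  have t: "?t i \<in> {1..k} \<longleftrightarrow> i \<in> {1..k}" for i
    using assms(1,2) by (auto simp: transpose_def)
  have lat: "latin_square k A" using assms(3) by (simp add: OLS_def)
  have "swap_symbols k a b A \<in> cells k \<rightarrow>\<^sub>E {1..k}"
  proof (rule PiE_I)
    fix p assume "p \<in> cells k"
    then show "swap_symbols k a b A p \<in> {1..k}"
      using lat t[of "A p"] by (auto simp: swap_symbols_def latin_square_def)
  qed (simp add: swap_symbols_def)
  moreover have "swap_symbols k a b A (i, j) = ?t (A (i, j))" if "i \<in> {1..k}" "j \<in> {1..k}" for i j
    using that by (simp add: swap_symbols_def cells_def)
  then have "inj_on (\<lambda>j. swap_symbols k a b A (i, j)) {1..k}"
    "inj_on (\<lambda>j. swap_symbols k a b A (j, i)) {1..k}" if "i \<in> {1..k}" for i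
    using that lat unfolding latin_square_def inj_on_def by (metis transpose_involutory)+
  ultimately have lat': "latin_square k (swap_symbols k a b A)"
    by (simp add: latin_square_def)
  \<comment> \<open>Relabelling acts on pairs of symbols, so here the permutation is composed after
    the cell map instead of before it.\<close>
  let ?f = "\<lambda>(i, j). (?t i, j)"
  have "bij_betw ?f (cells k) (cells k)"
    by (rule bij_betw_byWitness[where f' = ?f]) (auto simp: cells_def t simp del: atLeastAtMost_iff One_nat_def)
  then have "bij_betw (?f \<circ> (\<lambda>p. (A p, B p))) (cells k) (cells k)"
    using assms(3) by (auto simp: OLS_def orthogonal_def intro: bij_betw_trans)
  \<comment> \<open>The relabelled square agrees with the composite on the cells only, which is
    enough for a bijection on the cells.\<close>
  then have "bij_betw (\<lambda>p. (swap_symbols k a b A p, B p)) (cells k) (cells k)"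
    by (rule bij_betw_cong[THEN iffD1, rotated]) (simp add: swap_symbols_def)
  then show ?thesis using assms(3) lat' by (simp add: OLS_def orthogonal_def)
qed

section \<open>Working rules for the equivalence\<close>

lemma ols_equiv_move:
  assumes "(P, Q) \<in> ols_move k" "P \<in> OLS k" "Q \<in> OLS k"
  shows "(P, Q) \<in> ols_equiv k"
  using assms unfolding ols_equiv_def by blast

lemma ols_equiv_trans:
  assumes "(P, Q) \<in> ols_equiv k" "(Q, R) \<in> ols_equiv k"
  shows "(P, R) \<in> ols_equiv k"
  using assms equiv_ols_equiv[of k] by (meson equivE transE)

lemma ols_equiv_sym:
  assumes "(P, Q) \<in> ols_equiv k"
  shows "(Q, P) \<in> ols_equiv k"
  using assms equiv_ols_equiv[of k] by (meson equivE symE)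

lemma ols_equiv_refl:
  assumes "P \<in> OLS k"
  shows "(P, P) \<in> ols_equiv k"
  using assms unfolding ols_equiv_def by blast

lemma ols_equiv_in_OLS:
  assumes "(P, Q) \<in> ols_equiv k"
  shows "Q \<in> OLS k"
  using assms unfolding ols_equiv_def by blast

lemma ols_equiv_swap_squares:
  assumes "(A, B) \<in> OLS k"
  shows "((A, B), (B, A)) \<in> ols_equiv k"
  using ols_move.R6 assms swap_squares_in_OLS[OF assms] by (rule ols_equiv_move)

lemma ols_equiv_swap_rows:
  assumes "a \<in> {1..k}" "b \<in> {1..k}" "(A, B) \<in> OLS k"
  shows "((A, B), (swap_rows a b A, swap_rows a b B)) \<in> ols_equiv k"
  using assms by (intro ols_equiv_move ols_move.R1 swap_rows_in_OLS)

lemma ols_equiv_swap_cols: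
  assumes "a \<in> {1..k}" "b \<in> {1..k}" "(A, B) \<in> OLS k"
  shows "((A, B), (swap_cols a b A, swap_cols a b B)) \<in> ols_equiv k"
  using assms by (intro ols_equiv_move ols_move.R2 swap_cols_in_OLS)

lemma ols_equiv_swap_symbols_fst:
  assumes "a \<in> {1..k}" "b \<in> {1..k}" "(A, B) \<in> OLS k"
  shows "((A, B), (swap_symbols k a b A, B)) \<in> ols_equiv k"
  using assms by (intro ols_equiv_move ols_move.R3 swap_symbols_fst_in_OLS)

text \<open>That the result is again orthogonal follows from the case of the first square, by
  exchanging the two squares before and after.\<close>

lemma ols_equiv_swap_symbols_snd:
  assumes "a \<in> {1..k}" "b \<in> {1..k}" "(A, B) \<in> OLS k"
  shows "((A, B), (A, swap_symbols k a b B)) \<in> ols_equiv k"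
  using assms swap_squares_in_OLS[OF swap_symbols_fst_in_OLS[OF assms(1,2) swap_squares_in_OLS]]
  by (intro ols_equiv_move ols_move.R4)

section \<open>Normalising the first rows and the first column\<close>

text \<open>The first row is sorted from left to right: step \<open>m\<close> exchanges the symbol
  found in column \<open>Suc m\<close> with \<open>Suc m\<close> itself. Only symbols of the first
  square change, so \<open>B\<close> survives and the two squares can be treated one after the
  other.\<close>

lemma ols_equiv_normalise_first_row_fst:
  assumes "(A, B) \<in> OLS k" "m \<le> k"
  shows "\<exists>A'. ((A, B), (A', B)) \<in> ols_equiv k \<and> (\<forall>j\<in>{1..m}. A' (1, j) = j)"
  using assms(2)
proof (induction m)
  case 0
  then show ?case using ols_equiv_refl[OF assms(1)] by auto
next
  case (Suc m)
  then obtain A' where A': "((A, B), (A', B)) \<in> ols_equiv k" "\<forall>j\<in>{1..m}. A' (1, j) = j"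
    by auto
  let ?s = "A' (1, Suc m)"
  have OLS': "(A', B) \<in> OLS k" using A'(1) by (rule ols_equiv_in_OLS)
  then have lat: "latin_square k A'" by (simp add: OLS_def)
  have s: "?s \<in> {1..k}" using lat Suc.prems by (auto simp: latin_square_def cells_def)
  have inj: "inj_on (\<lambda>j. A' (1, j)) {1..k}"
    using lat Suc.prems by (auto simp: latin_square_def)
  have "swap_symbols k ?s (Suc m) A' (1, j) = j" if j: "j \<in> {1..Suc m}" for j
  proof (cases "j = Suc m")
    case True
    then show ?thesis using Suc.prems by (simp add: swap_symbols_def cells_def)
  next
    case False
    then have "A' (1, j) = j" using A'(2) j by simp
    \<comment> \<open>An entry \<open>j\<close> sorted earlier is neither of the two exchanged
      symbols: it differs from \<open>Suc m\<close>, and from \<open>?s\<close> because the row has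
      no repetition.\<close>
    moreover from this have "?s \<noteq> j"
      using False j Suc.prems inj_onD[OF inj, of j "Suc m"] by auto
    ultimately show ?thesis
      using False j Suc.prems by (simp add: swap_symbols_def cells_def)
  qed
  moreover have "((A', B), (swap_symbols k ?s (Suc m) A', B)) \<in> ols_equiv k"
    using s Suc.prems OLS' by (intro ols_equiv_swap_symbols_fst) auto
  ultimately show ?case using A'(1) ols_equiv_trans by blast
qed

lemma ols_equiv_normalise_first_rows:
  assumes "(A, B) \<in> OLS k"
  shows "\<exists>A' B'. ((A, B), (A', B')) \<in> ols_equiv k \<and>
    (\<forall>j\<in>{1..k}. A' (1, j) = j) \<and> (\<forall>j\<in>{1..k}. B' (1, j) = j)"
proof -
  obtain A' where A': "((A, B), (A', B)) \<in> ols_equiv k" "\<forall>j\<in>{1..k}. A' (1, j) = j"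
    using ols_equiv_normalise_first_row_fst[OF assms, of k] by auto
  \<comment> \<open>The second square is relabelled as the first component of the exchanged pair;
    exchanging back leaves \<open>A'\<close> as it was.\<close>
  have BA: "(B, A') \<in> OLS k" using ols_equiv_in_OLS[OF A'(1)] by (rule swap_squares_in_OLS)
  obtain B' where B': "((B, A'), (B', A')) \<in> ols_equiv k" "\<forall>j\<in>{1..k}. B' (1, j) = j"
    using ols_equiv_normalise_first_row_fst[OF BA, of k] by auto
  have "((A', B), (A', B')) \<in> ols_equiv k"
    using ols_equiv_swap_squares[OF swap_squares_in_OLS[OF BA]] B'(1)
      ols_equiv_swap_squares[OF ols_equiv_in_OLS[OF B'(1)]]
    by (blast intro: ols_equiv_trans)
  then show ?thesis using A' B'(2) ols_equiv_trans by blast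
qed

text \<open>The rows are sorted by their entry in the first column of the first square. Row 1
  already starts with 1, so the induction starts with one row in place and later exchanges touch
  only rows below it; hence both first rows stay sorted.\<close>

lemma ols_equiv_normalise_first_column:
  assumes "(A, B) \<in> OLS k" "\<forall>j\<in>{1..k}. A (1, j) = j" "\<forall>j\<in>{1..k}. B (1, j) = j"
    and "Suc m \<le> k"
  shows "\<exists>A' B'. ((A, B), (A', B')) \<in> ols_equiv k \<and>
    (\<forall>j\<in>{1..k}. A' (1, j) = j) \<and> (\<forall>j\<in>{1..k}. B' (1, j) = j) \<and>
    (\<forall>i\<in>{1..Suc m}. A' (i, 1) = i)"
  using assms(4)
proof (induction m)
  case 0
  then show ?case using ols_equiv_refl[OF assms(1)] assms(2,3)
    by (intro exI[of _ A] exI[of _ B]) auto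
next
  case (Suc m)
  then obtain A' B' where A': "((A, B), (A', B')) \<in> ols_equiv k"
      "\<forall>j\<in>{1..k}. A' (1, j) = j" "\<forall>j\<in>{1..k}. B' (1, j) = j" "\<forall>i\<in>{1..Suc m}. A' (i, 1) = i"
    by auto
  let ?n = "Suc (Suc m)"
  have OLS': "(A', B') \<in> OLS k" using A'(1) by (rule ols_equiv_in_OLS)
  then have lat: "latin_square k A'" by (simp add: OLS_def)
  \<comment> \<open>The first column is a permutation of \<open>{1..k}\<close>, so the symbol
    \<open>?n\<close> occurs in some row \<open>r\<close>.\<close>
  have "inj_on (\<lambda>i. A' (i, 1)) {1..k}" "(\<lambda>i. A' (i, 1)) ` {1..k} \<subseteq> {1..k}"
    using lat Suc.prems by (auto simp: latin_square_def cells_def)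
  then have "(\<lambda>i. A' (i, 1)) ` {1..k} = {1..k}" by (intro endo_inj_surj) auto
  moreover have "?n \<in> {1..k}" using Suc.prems by auto
  ultimately have "?n \<in> (\<lambda>i. A' (i, 1)) ` {1..k}" by simp
  then obtain r where r: "r \<in> {1..k}" "A' (r, 1) = ?n" by auto
  \<comment> \<open>The rows already in place start with \<open>1\<close>, ...,
    \<open>Suc m\<close>, all smaller than \<open>?n\<close>.\<close>
  have "r \<notin> {1..Suc m}"
  proof
    assume "r \<in> {1..Suc m}"
    then show False using r(2) A'(4) by (metis Suc_n_not_le_n atLeastAtMost_iff)
  qed
  then have "r > Suc m" using r(1) by auto
  then have low: "transpose r ?n i = i" if "i \<in> {1..Suc m}" for i
    using that by (auto simp: transpose_def)
  have "swap_rows r ?n A' (i, 1) = i" if "i \<in> {1..?n}" for i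
    using that low[of i] A'(4) r(2) by (cases "i = ?n") (auto simp: swap_rows_def)
  moreover have "((A', B'), (swap_rows r ?n A', swap_rows r ?n B')) \<in> ols_equiv k"
    using r Suc.prems OLS' by (intro ols_equiv_swap_rows) auto
  moreover have "transpose r ?n 1 = 1" using \<open>r > Suc m\<close> by (auto simp: transpose_def)
  then have "\<forall>j\<in>{1..k}. swap_rows r ?n A' (1, j) = j" "\<forall>j\<in>{1..k}. swap_rows r ?n B' (1, j) = j"
    using A'(2,3) by (simp_all add: swap_rows_def)
  ultimately show ?case using A'(1) ols_equiv_trans by blast
qed

section \<open>The Klein table and its two mates\<close>

text \<open>With 1 as zero, 2 as unit and 4 as a generator w of the field with four elements, the
  entry in row x and column y is x + y here, w x + y in \<open>klein_mate\<close> and w^2 x + y in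
  \<open>klein_mate'\<close>.\<close>

definition klein_square :: square where
  "klein_square = square_of_perms (transpose 1 2 \<circ> transpose 3 4)
     (transpose 1 4 \<circ> transpose 2 3) (transpose 1 2 \<circ> transpose 3 4)"

definition klein_mate :: square where
  "klein_mate = square_of_perms (transpose 1 4 \<circ> transpose 2 3)
     (transpose 1 3 \<circ> transpose 2 4) (transpose 1 4 \<circ> transpose 2 3)"

definition klein_mate' :: square where
  "klein_mate' = square_of_perms (transpose 1 3 \<circ> transpose 2 4)
     (transpose 1 2 \<circ> transpose 3 4) (transpose 1 3 \<circ> transpose 2 4)"

lemma atLeastAtMost_4: "{1..4::nat} = {1, 2, 3, 4}"
  by auto

lemma cells_4: "cells 4 = {1, 2, 3, 4} \<times> {1, 2, 3, 4}"
  unfolding cells_def atLeastAtMost_4 ..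

lemma klein_values:
  "klein_square (1, 1) = 1" "klein_square (1, 2) = 2" "klein_square (1, 3) = 3" "klein_square (1, 4) = 4"
  "klein_square (2, 1) = 2" "klein_square (2, 2) = 1" "klein_square (2, 3) = 4" "klein_square (2, 4) = 3"
  "klein_square (3, 1) = 3" "klein_square (3, 2) = 4" "klein_square (3, 3) = 1" "klein_square (3, 4) = 2"
  "klein_square (4, 1) = 4" "klein_square (4, 2) = 3" "klein_square (4, 3) = 2" "klein_square (4, 4) = 1"
  by (simp_all add: klein_square_def square_of_perms_def cells_4 transpose_def)

lemma klein_mate_values:
  "klein_mate (1, 1) = 1" "klein_mate (1, 2) = 2" "klein_mate (1, 3) = 3" "klein_mate (1, 4) = 4"
  "klein_mate (2, 1) = 4" "klein_mate (2, 2) = 3" "klein_mate (2, 3) = 2" "klein_mate (2, 4) = 1"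
  "klein_mate (3, 1) = 2" "klein_mate (3, 2) = 1" "klein_mate (3, 3) = 4" "klein_mate (3, 4) = 3"
  "klein_mate (4, 1) = 3" "klein_mate (4, 2) = 4" "klein_mate (4, 3) = 1" "klein_mate (4, 4) = 2"
  by (simp_all add: klein_mate_def square_of_perms_def cells_4 transpose_def)

lemma klein_mate'_values:
  "klein_mate' (1, 1) = 1" "klein_mate' (1, 2) = 2" "klein_mate' (1, 3) = 3" "klein_mate' (1, 4) = 4"
  "klein_mate' (2, 1) = 3" "klein_mate' (2, 2) = 4" "klein_mate' (2, 3) = 1" "klein_mate' (2, 4) = 2"
  "klein_mate' (3, 1) = 4" "klein_mate' (3, 2) = 3" "klein_mate' (3, 3) = 2" "klein_mate' (3, 4) = 1"
  "klein_mate' (4, 1) = 2" "klein_mate' (4, 2) = 1" "klein_mate' (4, 3) = 4" "klein_mate' (4, 4) = 3"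
  by (simp_all add: klein_mate'_def square_of_perms_def cells_4 transpose_def)

text \<open>Simplification rewrites the index \<open>1\<close> to \<open>Suc 0\<close>; the
  equations are kept in that form so that they still match.\<close>

lemmas klein_simps =
  klein_values[unfolded One_nat_def] klein_mate_values[unfolded One_nat_def]
  klein_mate'_values[unfolded One_nat_def]

lemma klein_arb:
  assumes "p \<notin> cells 4"
  shows "klein_square p = undefined" "klein_mate p = undefined" "klein_mate' p = undefined"
  using assms by (simp_all add: klein_square_def klein_mate_def klein_mate'_def square_of_perms_def)

lemma latin_square_klein:
  "latin_square 4 klein_square" "latin_square 4 klein_mate" "latin_square 4 klein_mate'"
  unfolding latin_square_def PiE_def extensional_def Pi_def atLeastAtMost_4
  by (auto simp: klein_arb klein_simps cells_4)

text \<open>A map of a finite set to itself that is onto is bijective. For concrete squares it is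
  then enough to find every pair of symbols among the values.\<close>

lemma orthogonalI_surj:
  assumes "cells k \<subseteq> (\<lambda>p. (A p, B p)) ` cells k"
  shows "orthogonal k A B"
proof -
  let ?f = "\<lambda>p. (A p, B p)"
  have fin: "finite (cells k)" by (simp add: cells_def)
  then have "card (?f ` cells k) = card (cells k)"
    using card_mono[OF _ assms] card_image_le[OF fin, of ?f] by auto
  then have "inj_on ?f (cells k)" by (rule eq_card_imp_inj_on[OF fin])
  moreover have "cells k = ?f ` cells k"
    using card_subset_eq[OF finite_imageI[OF fin] assms] \<open>card _ = _\<close> by simp
  ultimately show ?thesis by (simp add: orthogonal_def bij_betw_def)
qed

lemma klein_pairs_in_OLS:
  "(klein_square, klein_mate) \<in> OLS 4" "(klein_mate, klein_mate') \<in> OLS 4"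
  "(klein_square, klein_mate') \<in> OLS 4"
proof -
  have "orthogonal 4 klein_square klein_mate" "orthogonal 4 klein_mate klein_mate'"
    "orthogonal 4 klein_square klein_mate'"
    by (rule orthogonalI_surj, simp add: cells_4 Sigma_def klein_simps)+
  then show "(klein_square, klein_mate) \<in> OLS 4" "(klein_mate, klein_mate') \<in> OLS 4"
    "(klein_square, klein_mate') \<in> OLS 4"
    by (simp_all add: OLS_def latin_square_klein)
qed

lemma klein_mate'_equiv_klein_mate:
  "((klein_square, klein_mate'), (klein_square, klein_mate)) \<in> ols_equiv 4"
proof -
  \<comment> \<open>Exchanging 3 and 4 is the Frobenius map of the field with four elements: it
    respects sums and exchanges w and w^2, so \<open>?f\<close> fixes x + y and exchanges w x + y
    with w^2 x + y.\<close>
  let ?f = "\<lambda>M. swap_symbols 4 3 4 (swap_cols 3 4 (swap_rows 3 4 M))"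
  have eq: "M' = ?f M"
    if "\<And>p. p \<notin> cells 4 \<Longrightarrow> M' p = undefined" "\<forall>p\<in>cells 4. M' p = ?f M p" for M M'
    using that by (intro ext) (auto simp: swap_symbols_def)
  have K: "klein_square = ?f klein_square"
    by (rule eq) (simp_all add: klein_arb,
      simp add: swap_symbols_def swap_cols_def swap_rows_def transpose_def cells_4 klein_simps)
  have M: "klein_mate = ?f klein_mate'"
    by (rule eq) (simp_all add: klein_arb,
      simp add: swap_symbols_def swap_cols_def swap_rows_def transpose_def cells_4 klein_simps)
  have 34: "(3::nat) \<in> {1..4}" "(4::nat) \<in> {1..4}" by auto
  \<comment> \<open>Four moves apply \<open>?f\<close> to both squares: rows and columns are
    exchanged jointly, the symbols in each square separately.\<close>
  note rows = ols_equiv_swap_rows[OF 34 klein_pairs_in_OLS(3)]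
  note cols = ols_equiv_swap_cols[OF 34 ols_equiv_in_OLS[OF rows]]
  note fsts = ols_equiv_swap_symbols_fst[OF 34 ols_equiv_in_OLS[OF cols]]
  note snds = ols_equiv_swap_symbols_snd[OF 34 ols_equiv_in_OLS[OF fsts]]
  show ?thesis
    using ols_equiv_trans[OF ols_equiv_trans[OF ols_equiv_trans[OF rows cols] fsts] snds]
    unfolding K[symmetric] M[symmetric] .
qed

section \<open>Classification of the normalised pairs\<close>

text \<open>The borders 2, 3, 4 leave \<open>a22\<close> in {1, 3, 4}. The values 3 and 4 force all
  other entries; the value 1 leaves the lower right 2 by 2 block over {1, 2}, with two fillings. The
  first list is the Klein table, the others are cyclic tables with 2, 3 and 4 as the element of
  order 2.\<close>

lemma reduced_latin_4:
  fixes a22 a23 a24 a32 a33 a34 a42 a43 a44 :: nat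
  assumes "a22 \<in> {1,2,3,4}" "a23 \<in> {1,2,3,4}" "a24 \<in> {1,2,3,4}"
    "a32 \<in> {1,2,3,4}" "a33 \<in> {1,2,3,4}" "a34 \<in> {1,2,3,4}"
    "a42 \<in> {1,2,3,4}" "a43 \<in> {1,2,3,4}" "a44 \<in> {1,2,3,4}"
    and "distinct [2, a22, a23, a24]" "distinct [3, a32, a33, a34]" "distinct [4, a42, a43, a44]"
    and "distinct [2, a22, a32, a42]" "distinct [3, a23, a33, a43]" "distinct [4, a24, a34, a44]"
  shows "[a22, a23, a24, a32, a33, a34, a42, a43, a44] \<in>
    {[1,4,3, 4,1,2, 3,2,1], [1,4,3, 4,2,1, 3,1,2], [3,4,1, 4,1,2, 1,2,3], [4,1,3, 1,4,2, 3,2,1]}"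
  using assms by simp (smt (z3))

lemma latin_square_eqI:
  assumes "latin_square k M" "latin_square k N" "\<forall>p\<in>cells k. M p = N p"
  shows "M = N"
  using assms unfolding latin_square_def by (intro PiE_ext[of M "cells k" _ N]) auto

lemma normalised_OLS_4:
  assumes "(A, B) \<in> OLS 4" "\<forall>j\<in>{1..4}. A (1, j) = j" "\<forall>j\<in>{1..4}. B (1, j) = j"
    and "\<forall>i\<in>{1..4}. A (i, 1) = i"
  shows "A = klein_square \<and> (B = klein_mate \<or> B = klein_mate')"
proof -
  have lat: "latin_square 4 A" "latin_square 4 B" and "orthogonal 4 A B"
    using assms(1) by (auto simp: OLS_def)
  then have ort: "B p \<noteq> B q" if "A p = A q" "p \<in> cells 4" "q \<in> cells 4" "p \<noteq> q" for p q
    using that by (auto simp: orthogonal_def bij_betw_def inj_on_def)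
  have row: "distinct [M (i, 1), M (i, 2), M (i, 3), M (i, 4)]"
    and col: "distinct [M (1, i), M (2, i), M (3, i), M (4, i)]"
    if "latin_square 4 M" "i \<in> {1, 2, 3, 4}" for M i
    using that unfolding latin_square_def atLeastAtMost_4 inj_on_def by auto
  have ran: "M (i, j) \<in> {1, 2, 3, 4}"
    if "latin_square 4 M" "i \<in> {1, 2, 3, 4}" "j \<in> {1, 2, 3, 4}" for M i j
  proof -
    have "M \<in> cells 4 \<rightarrow>\<^sub>E {1..4}" using that(1) by (simp only: latin_square_def)
    moreover have "(i, j) \<in> cells 4" unfolding cells_4 using that(2,3) by (rule SigmaI)
    ultimately have "M (i, j) \<in> {1..4}" by (rule PiE_mem)
    then show ?thesis by (simp only: atLeastAtMost_4)
  qed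
  have A1: "A (1, 1) = 1" "A (1, 2) = 2" "A (1, 3) = 3" "A (1, 4) = 4"
    and A2: "A (2, 1) = 2" and A3: "A (3, 1) = 3" and A4: "A (4, 1) = 4"
    and B1: "B (1, 1) = 1" "B (1, 2) = 2" "B (1, 3) = 3" "B (1, 4) = 4"
    using assms(2-4) by simp_all
  \<comment> \<open>Both first rows are the identity, so the pairs \<open>(s, s)\<close> are already taken.\<close>
  have dom: "B (i, j) \<in> S"
    if "i \<in> {2, 3, 4}" "j \<in> {1, 2, 3, 4}" "{1, 2, 3, 4} - {j, A (i, j)} \<subseteq> S" for i j S
  proof -
    have Aij: "A (i, j) \<in> {1, 2, 3, 4}" using ran[OF lat(1)] that(1,2) by auto
    then have "A (1, A (i, j)) = A (i, j)" "B (1, A (i, j)) = A (i, j)" using A1 B1 by auto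
    then have "B (i, j) \<noteq> A (i, j)"
      using ort[of "(i, j)" "(1, A (i, j))"] Aij that(1,2) by (auto simp: cells_def)
    moreover have "B (i, j) \<noteq> j" using col[OF lat(2) that(2)] that(1,2) B1 by auto
    moreover have "B (i, j) \<in> {1, 2, 3, 4}" using ran[OF lat(2)] that(1,2) by auto
    ultimately show ?thesis using that(3) by blast
  qed
  have rows: "distinct [B (2, 1), B (2, 2), B (2, 3), B (2, 4)]"
    "distinct [B (3, 1), B (3, 2), B (3, 3), B (3, 4)]"
    "distinct [B (4, 1), B (4, 2), B (4, 3), B (4, 4)]"
    by (rule row[OF lat(2)], simp)+
  have cols: "distinct [B (1, 1), B (2, 1), B (3, 1), B (4, 1)]"
    "distinct [B (1, 2), B (2, 2), B (3, 2), B (4, 2)]"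
    "distinct [B (1, 3), B (2, 3), B (3, 3), B (4, 3)]"
    "distinct [B (1, 4), B (2, 4), B (3, 4), B (4, 4)]"
    by (rule col[OF lat(2)], simp)+
  \<comment> \<open>These are the nine cells outside the fixed first row and column, read row by
    row.\<close>
  let ?a = "[A (2, 2), A (2, 3), A (2, 4), A (3, 2), A (3, 3), A (3, 4), A (4, 2), A (4, 3), A (4, 4)]"
  have "?a \<in> {[1,4,3, 4,1,2, 3,2,1], [1,4,3, 4,2,1, 3,1,2], [3,4,1, 4,1,2, 1,2,3], [4,1,3, 1,4,2, 3,2,1]}"
    using row[OF lat(1), of 2] row[OF lat(1), of 3] row[OF lat(1), of 4]
      col[OF lat(1), of 2] col[OF lat(1), of 3] col[OF lat(1), of 4] A1 A2 A3 A4
    by (intro reduced_latin_4 ran[OF lat(1)]) auto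
  then show ?thesis
  proof (elim insertE emptyE)
    assume 1: "?a = [1,4,3, 4,1,2, 3,2,1]"
    \<comment> \<open>Each cell loses its column number and its entry in \<open>A\<close>, which
      leaves two candidates.\<close>
    have doms: "B (2, 1) \<in> {3, 4}" "B (2, 2) \<in> {3, 4}" "B (2, 3) \<in> {1, 2}" "B (2, 4) \<in> {1, 2}"
      "B (3, 1) \<in> {2, 4}" "B (3, 2) \<in> {1, 3}" "B (3, 3) \<in> {2, 4}" "B (3, 4) \<in> {1, 3}"
      "B (4, 1) \<in> {2, 3}" "B (4, 2) \<in> {1, 4}" "B (4, 3) \<in> {1, 4}" "B (4, 4) \<in> {2, 3}"
      using 1 A2 A3 A4 by - (rule dom, simp, simp, simp add: insert_Diff_if)+
    \<comment> \<open>Each line collects the four cells where \<open>A\<close> has one given symbol;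
      orthogonality makes \<open>B\<close> injective on them.\<close>
    have syms: "distinct [B (1, 1), B (2, 2), B (3, 3), B (4, 4)]"
      "distinct [B (1, 2), B (2, 1), B (3, 4), B (4, 3)]"
      "distinct [B (1, 3), B (2, 4), B (3, 1), B (4, 2)]"
      "distinct [B (1, 4), B (2, 3), B (3, 2), B (4, 1)]"
      using 1 A1 A2 A3 A4 by (simp_all add: ort cells_4)
    have "A = klein_square"
      using lat(1) latin_square_klein(1)
      by (rule latin_square_eqI) (use 1 A1 A2 A3 A4 in \<open>simp add: cells_4 klein_simps\<close>)
    \<comment> \<open>The value of \<open>B (2, 1)\<close>, 4 or 3, determines all the others; the
      two outcomes are the two mates.\<close>
    moreover have "[B (2, 1), B (2, 2), B (2, 3), B (2, 4), B (3, 1), B (3, 2), B (3, 3), B (3, 4),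
        B (4, 1), B (4, 2), B (4, 3), B (4, 4)] \<in> {[4,3,2,1, 2,1,4,3, 3,4,1,2], [3,4,1,2, 4,3,2,1, 2,1,4,3]}"
      using doms rows cols syms by simp (smt (z3))
    then have "(\<forall>p\<in>cells 4. B p = klein_mate p) \<or> (\<forall>p\<in>cells 4. B p = klein_mate' p)"
      using B1 by (elim insertE emptyE) (simp_all add: cells_4 klein_simps)
    then have "B = klein_mate \<or> B = klein_mate'"
      using latin_square_eqI[OF lat(2)] latin_square_klein(2,3) by blast
    ultimately show ?thesis by blast
  next
    \<comment> \<open>In this and the next two cases the constraints contradict each other. The
      cells carrying one symbol of \<open>B\<close> would meet every row, column and symbol of a
      cyclic table of order 4 once. Summing over them, the rows and columns together give twice the
      sum of the group, which is zero, whereas the symbols give the sum of the group, its element of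
      order 2.\<close>
    assume 2: "?a = [1,4,3, 4,2,1, 3,1,2]"
    have doms: "B (2, 1) \<in> {3, 4}" "B (2, 2) \<in> {3, 4}" "B (2, 3) \<in> {1, 2}" "B (2, 4) \<in> {1, 2}"
      "B (3, 1) \<in> {2, 4}" "B (3, 2) \<in> {1, 3}" "B (3, 3) \<in> {1, 4}" "B (3, 4) \<in> {2, 3}"
      "B (4, 1) \<in> {2, 3}" "B (4, 2) \<in> {1, 4}" "B (4, 3) \<in> {2, 4}" "B (4, 4) \<in> {1, 3}"
      using 2 A2 A3 A4 by - (rule dom, simp, simp, simp add: insert_Diff_if)+
    have syms: "distinct [B (1, 1), B (2, 2), B (3, 4), B (4, 3)]"
      "distinct [B (1, 2), B (2, 1), B (3, 3), B (4, 4)]"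
      "distinct [B (1, 3), B (2, 4), B (3, 1), B (4, 2)]"
      "distinct [B (1, 4), B (2, 3), B (3, 2), B (4, 1)]"
      using 2 A1 A2 A3 A4 by (simp_all add: ort cells_4)
    from doms rows cols syms show ?thesis by simp (smt (z3))
  next
    assume 3: "?a = [3,4,1, 4,1,2, 1,2,3]"
    have doms: "B (2, 1) \<in> {3, 4}" "B (2, 2) \<in> {1, 4}" "B (2, 3) \<in> {1, 2}" "B (2, 4) \<in> {2, 3}"
      "B (3, 1) \<in> {2, 4}" "B (3, 2) \<in> {1, 3}" "B (3, 3) \<in> {2, 4}" "B (3, 4) \<in> {1, 3}"
      "B (4, 1) \<in> {2, 3}" "B (4, 2) \<in> {3, 4}" "B (4, 3) \<in> {1, 4}" "B (4, 4) \<in> {1, 2}"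
      using 3 A2 A3 A4 by - (rule dom, simp, simp, simp add: insert_Diff_if)+
    have syms: "distinct [B (1, 1), B (2, 4), B (3, 3), B (4, 2)]"
      "distinct [B (1, 2), B (2, 1), B (3, 4), B (4, 3)]"
      "distinct [B (1, 3), B (2, 2), B (3, 1), B (4, 4)]"
      "distinct [B (1, 4), B (2, 3), B (3, 2), B (4, 1)]"
      using 3 A1 A2 A3 A4 by (simp_all add: ort cells_4)
    from doms rows cols syms show ?thesis by simp (smt (z3))
  next
    assume 4: "?a = [4,1,3, 1,4,2, 3,2,1]"
    have doms: "B (2, 1) \<in> {3, 4}" "B (2, 2) \<in> {1, 3}" "B (2, 3) \<in> {2, 4}" "B (2, 4) \<in> {1, 2}"
      "B (3, 1) \<in> {2, 4}" "B (3, 2) \<in> {3, 4}" "B (3, 3) \<in> {1, 2}" "B (3, 4) \<in> {1, 3}"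
      "B (4, 1) \<in> {2, 3}" "B (4, 2) \<in> {1, 4}" "B (4, 3) \<in> {1, 4}" "B (4, 4) \<in> {2, 3}"
      using 4 A2 A3 A4 by - (rule dom, simp, simp, simp add: insert_Diff_if)+
    have syms: "distinct [B (1, 1), B (2, 3), B (3, 2), B (4, 4)]"
      "distinct [B (1, 2), B (2, 1), B (3, 4), B (4, 3)]"
      "distinct [B (1, 3), B (2, 4), B (3, 1), B (4, 2)]"
      "distinct [B (1, 4), B (2, 2), B (3, 3), B (4, 1)]"
      using 4 A1 A2 A3 A4 by (simp_all add: ort cells_4)
    from doms rows cols syms show ?thesis by simp (smt (z3))
  qed
qed

section \<open>Reduction of all pairs to one class\<close>

lemma OLS_4_equiv_klein:
  assumes "P \<in> OLS 4"
  shows "(P, (klein_square, klein_mate)) \<in> ols_equiv 4"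
proof -
  obtain A B where P: "P = (A, B)" by fastforce
  obtain A1 B1 where 1: "((A, B), (A1, B1)) \<in> ols_equiv 4"
      "\<forall>j\<in>{1..4}. A1 (1, j) = j" "\<forall>j\<in>{1..4}. B1 (1, j) = j"
    using ols_equiv_normalise_first_rows assms unfolding P by blast
  obtain A2 B2 where 2: "((A1, B1), (A2, B2)) \<in> ols_equiv 4"
      "\<forall>j\<in>{1..4}. A2 (1, j) = j" "\<forall>j\<in>{1..4}. B2 (1, j) = j" "\<forall>i\<in>{1..4}. A2 (i, 1) = i"
    \<comment> \<open>The column normalisation reaches row \<open>Suc m\<close>, so
      \<open>m = 3\<close> covers all four rows.\<close>
    using ols_equiv_normalise_first_column[OF ols_equiv_in_OLS[OF 1(1)] 1(2,3), of 3] by auto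
  have "A2 = klein_square" "B2 = klein_mate \<or> B2 = klein_mate'"
    using normalised_OLS_4[OF ols_equiv_in_OLS[OF 2(1)] 2(2-4)] by auto
  moreover have "(P, (A2, B2)) \<in> ols_equiv 4"
    unfolding P using 1(1) 2(1) by (rule ols_equiv_trans)
  ultimately show ?thesis
    using ols_equiv_trans[OF _ klein_mate'_equiv_klein_mate, of P] by auto
qed

theorem theorem3p5:
  fixes \<tau> :: "nat \<Rightarrow> nat \<Rightarrow> nat" and L :: "nat \<Rightarrow> square"
  assumes "\<tau> 1 = transpose 1 2 \<circ> transpose 3 4"
    and "\<tau> 2 = transpose 1 4 \<circ> transpose 2 3"
    and "\<tau> 3 = transpose 1 3 \<circ> transpose 2 4"
    and "L 1 = square_of_perms (\<tau> 1) (\<tau> 2) (\<tau> 1)"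
    and "L 2 = square_of_perms (\<tau> 2) (\<tau> 3) (\<tau> 2)"
    and "L 3 = square_of_perms (\<tau> 3) (\<tau> 1) (\<tau> 3)"
  shows "(\<forall>i\<in>{1, 2, 3}. \<forall>j\<in>{1, 2, 3}. i \<noteq> j \<longrightarrow> (L i, L j) \<in> OLS 4)
    \<and> (\<forall>i\<in>{1, 2, 3}. \<forall>j\<in>{1, 2, 3}. \<forall>i'\<in>{1, 2, 3}. \<forall>j'\<in>{1, 2, 3}.
          i \<noteq> j \<longrightarrow> i' \<noteq> j' \<longrightarrow> ((L i, L j), (L i', L j')) \<in> ols_equiv 4)
    \<and> (\<forall>P\<in>OLS 4. (P, (L 1, L 2)) \<in> ols_equiv 4)
    \<and> OLS 4 // ols_equiv 4 = {ols_equiv 4 `` {(L 1, L 2)}}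
    \<and> card (OLS 4 // ols_equiv 4) = 1"
proof -
  have L: "L 1 = klein_square" "L 2 = klein_mate" "L 3 = klein_mate'"
    unfolding assms klein_square_def klein_mate_def klein_mate'_def by (rule refl)+
  have in_OLS: "\<forall>i\<in>{1, 2, 3}. \<forall>j\<in>{1, 2, 3}. i \<noteq> j \<longrightarrow> (L i, L j) \<in> OLS 4"
    using klein_pairs_in_OLS klein_pairs_in_OLS[THEN swap_squares_in_OLS]
    by (simp add: L L(1)[unfolded One_nat_def])
  have all: "\<forall>P\<in>OLS 4. (P, (L 1, L 2)) \<in> ols_equiv 4"
    using OLS_4_equiv_klein unfolding L by blast
  \<comment> \<open>Any two orthogonal pairs are linked through \<open>(L 1, L 2)\<close>. Both the
    equivalence of the pairs \<open>(L i, L j)\<close> and the single class follow from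
    this.\<close>
  then have equiv: "(P, Q) \<in> ols_equiv 4" if "P \<in> OLS 4" "Q \<in> OLS 4" for P Q
    using that by (blast intro: ols_equiv_trans ols_equiv_sym)
  have "(L 1, L 2) \<in> OLS 4" using in_OLS by auto
  then have quot: "OLS 4 // ols_equiv 4 = {ols_equiv 4 `` {(L 1, L 2)}}"
    using equiv_class_eq[OF equiv_ols_equiv] equiv unfolding quotient_def by blast
  then have "card (OLS 4 // ols_equiv 4) = 1" by simp
  moreover have "\<forall>i\<in>{1, 2, 3}. \<forall>j\<in>{1, 2, 3}. \<forall>i'\<in>{1, 2, 3}. \<forall>j'\<in>{1, 2, 3}.
      i \<noteq> j \<longrightarrow> i' \<noteq> j' \<longrightarrow> ((L i, L j), (L i', L j')) \<in> ols_equiv 4"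
  proof (intro ballI impI)
    fix i j i' j' :: nat
    assume "i \<in> {1, 2, 3}" "j \<in> {1, 2, 3}" "i' \<in> {1, 2, 3}" "j' \<in> {1, 2, 3}" "i \<noteq> j" "i' \<noteq> j'"
    then show "((L i, L j), (L i', L j')) \<in> ols_equiv 4"
      by (intro equiv in_OLS[rule_format])
  qed
  ultimately show ?thesis using in_OLS all quot by blast
qed

end
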